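(* Assume the principle NCF (near coherence of filters). Let $X$ be a countable topological space. Then the following conditions are equivalent: (1) $X$ is $S$-separable; (2) $X$ is $mS$-separable; (3) $X$ is $M$-separable.
   Context: $\omega$ is the set of natural numbers, each $k\in\omega$ is identified with $\{0,\dots,k-1\}$, and $[D]^{<\omega}$ denotes the set of finite subsets of $D$. NCF is the statement: for any two non-principal filters $\mathcal U_0,\mathcal U_1$ on $\omega$ there exists a monotone (non-decreasing) surjection $\phi:\omega\to\omega$ such that $\phi[\mathcal U_0]\cup\phi[\mathcal U_1]$ is centered, i.e., $\bigcap\mathcal C$ is infinite for any finite $\mathcal C\subset\phi[\mathcal U_0]\cup\phi[\mathcal U_1]$. Here $\phi[\mathcal U]=\{\phi[U]:U\in\mathcal U\}$. A topological space $X$ is $M$-separable if for every sequence $\langle D_n:n\in\omega\rangle$ of dense subsets of $X$ there are finite sets $F_n\subset D_n$, $n\in\omega$, such that $\bigcup_{n\in\omega}F_n$ is dense in $X$. $X$ is $S$-separable if for every sequence $\langle D_n:n\in\omega\rangle$ of dense subsets of $X$ there exists a sequence $\langle F_n:n\in\omega\rangle$ such that $F_n\in[D_n]^{<\omega}$ for all $n\in\omega$, and for every finite family $\{U_i:i\in k\}$ of non-empty open subsets of $X$ there exists $n\in\omega$ with $U_i\cap F_n\neq\emptyset$ for all $i\in k$. $X$ is $mS$-separable if the condition in the definition of $S$-separability holds for all decreasing sequences $\langle D_n:n\in\omega\rangle$ (i.e., $D_{n+1}\subset D_n$ for all $n$) of dense subsets of $X$. *)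

theory Defs
  imports "HOL-Analysis.Analysis"
begin

(* Filters on the natural numbers are elements of the library type "nat filter"; a set U is a
   member of F iff "eventually (\<lambda>n. n \<in> U) F".  The improper filter is bot = principal {}, so it
   counts as principal and is excluded from NCF below. *)

definition nonprincipal :: "'a filter \<Rightarrow> bool" where
  "nonprincipal F \<longleftrightarrow> (\<forall>A. F \<noteq> principal A)"

definition image_sets :: "('a \<Rightarrow> 'b) \<Rightarrow> 'a filter \<Rightarrow> 'b set set" where
  "image_sets \<phi> F = {\<phi> ` U | U. eventually (\<lambda>n. n \<in> U) F}"

(* Centered in the strong sense: finite intersections are infinite, not just non-empty. *)
definition centered :: "nat set set \<Rightarrow> bool" where
  "centered \<A> \<longleftrightarrow> (\<forall>\<C>. finite \<C> \<and> \<C> \<subseteq> \<A> \<longrightarrow> infinite (\<Inter>\<C>))"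

definition NCF :: bool where
  "NCF \<longleftrightarrow> (\<forall>F G :: nat filter. nonprincipal F \<and> nonprincipal G \<longrightarrow>
     (\<exists>\<phi> :: nat \<Rightarrow> nat. mono \<phi> \<and> surj \<phi> \<and> centered (image_sets \<phi> F \<union> image_sets \<phi> G)))"

definition dense_subset :: "'a topology \<Rightarrow> 'a set \<Rightarrow> bool" where
  "dense_subset X D \<longleftrightarrow> D \<subseteq> topspace X \<and> X closure_of D = topspace X"

definition M_separable :: "'a topology \<Rightarrow> bool" where
  "M_separable X \<longleftrightarrow> (\<forall>D :: nat \<Rightarrow> 'a set. (\<forall>n. dense_subset X (D n)) \<longrightarrow>
     (\<exists>F :: nat \<Rightarrow> 'a set. (\<forall>n. finite (F n) \<and> F n \<subseteq> D n) \<and> dense_subset X (\<Union>n. F n)))"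

definition S_selects :: "'a topology \<Rightarrow> (nat \<Rightarrow> 'a set) \<Rightarrow> (nat \<Rightarrow> 'a set) \<Rightarrow> bool" where
  "S_selects X D F \<longleftrightarrow> (\<forall>n. finite (F n) \<and> F n \<subseteq> D n) \<and>
     (\<forall>(k :: nat) U. (\<forall>i<k. openin X (U i) \<and> U i \<noteq> {}) \<longrightarrow> (\<exists>n. \<forall>i<k. U i \<inter> F n \<noteq> {}))"

definition S_separable :: "'a topology \<Rightarrow> bool" where
  "S_separable X \<longleftrightarrow> (\<forall>D :: nat \<Rightarrow> 'a set. (\<forall>n. dense_subset X (D n)) \<longrightarrow> (\<exists>F. S_selects X D F))"

definition mS_separable :: "'a topology \<Rightarrow> bool" where
  "mS_separable X \<longleftrightarrow> (\<forall>D :: nat \<Rightarrow> 'a set.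
     (\<forall>n. dense_subset X (D n)) \<and> (\<forall>n. D (Suc n) \<subseteq> D n) \<longrightarrow> (\<exists>F. S_selects X D F))"

end

theory Submission
  imports Defs
begin

text \<open>
  For M \<open>\<Longrightarrow>\<close> S, NCF yields a free ultrafilter \<open>H\<close> with a base \<open>\<B>\<close> of fewer than d sets
  (d is the dominating number): otherwise a recursion of length d along a dominating family builds
  two filters that no monotone surjection makes coherent. Given dense sets \<open>D n\<close> in a countable space enumerated by \<open>x\<close>,
  M-separability along each \<open>B \<in> \<B>\<close> gives a function \<open>G B\<close> such that every non-empty open \<open>U\<close> meets
  \<open>D n \<inter> x ` {..G B n}\<close> for infinitely many \<open>n \<in> B\<close>. For \<open>U\<close> ranging over the neighbourhoods of a
  point, these sets of indices generate a filter, which is nearly coherent with \<open>H\<close>. Hence fewer than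
  d functions control all the situations at once, and a single \<open>g\<close> not dominated by any of
  them has \<open>{n. U \<inter> D n \<inter> x ` {..g n} \<noteq> {}}\<close> meeting every \<open>B \<in> \<B>\<close>, so that it belongs to \<open>H\<close>.
  Finitely many members of \<open>H\<close> intersect, which is S-separability. For mS \<open>\<Longrightarrow>\<close> M, apply
  mS-separability to the tail unions of \<open>D\<close> and charge each selected point to a later index.
\<close>

section \<open>Index sets of size below d\<close>

text \<open>This says that the cardinality of \<open>I\<close> is less than d; the form below makes closure under countable
  unions immediate and needs cardinal arithmetic only for products.\<close>
definition small :: "'i set \<Rightarrow> bool" where
  "small I \<longleftrightarrow> (\<forall>h :: 'i \<Rightarrow> nat \<Rightarrow> nat. \<exists>g. \<forall>i\<in>I. \<exists>\<^sub>F n in at_top. h i n < g n)"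

lemma not_small_dominating:
  assumes "\<not> small I"
  obtains h :: "'i \<Rightarrow> nat \<Rightarrow> nat" where "\<And>g. \<exists>i\<in>I. \<forall>\<^sub>F n in at_top. g n \<le> h i n"
  using assms unfolding small_def frequently_def by (auto simp: not_less)

text \<open>Partial sums of any witness give a monotone one. Monotonicity lets the final argument
  pass from \<open>g b\<close> to \<open>g m\<close> for a later index \<open>m\<close>.\<close>

lemma small_nondominating_mono:
  assumes "small I"
  shows "\<exists>g. mono g \<and> (\<forall>i\<in>I. \<exists>\<^sub>F n in at_top. (h :: 'i \<Rightarrow> nat \<Rightarrow> nat) i n < g n)"
proof -
  obtain g where g: "\<forall>i\<in>I. \<exists>\<^sub>F n in at_top. h i n < g n"
    using assms unfolding small_def by blast
  have "g n \<le> (\<Sum>m\<le>n. g m)" for n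
    by (rule member_le_sum) auto
  then have less: "h i n < (\<Sum>m\<le>n. g m)" if "h i n < g n" for i n
    using that less_le_trans by blast
  have "\<forall>i\<in>I. \<exists>\<^sub>F n in at_top. h i n < (\<Sum>m\<le>n. g m)"
  proof
    fix i assume "i \<in> I"
    with g have "\<exists>\<^sub>F n in at_top. h i n < g n" ..
    then show "\<exists>\<^sub>F n in at_top. h i n < (\<Sum>m\<le>n. g m)"
      by (rule frequently_elim1) (rule less)
  qed
  moreover have "mono (\<lambda>n. \<Sum>m\<le>n. g m)"
    by (intro monoI sum_mono2) auto
  ultimately show ?thesis by blast
qed

lemma small_subset:
  assumes "small I" "J \<subseteq> I" shows "small J"
  unfolding small_def
proof
  fix h :: "'a \<Rightarrow> nat \<Rightarrow> nat"
  obtain g where "\<forall>i\<in>I. \<exists>\<^sub>F n in at_top. h i n < g n"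
    using assms(1) unfolding small_def by blast
  with assms(2) show "\<exists>g. \<forall>i\<in>J. \<exists>\<^sub>F n in at_top. h i n < g n"
    by (intro exI[of _ g]) (rule ballI, drule (1) subsetD, erule (1) bspec)
qed

lemma small_image:
  assumes "small I" shows "small (f ` I)"
  unfolding small_def
proof
  fix h :: "'b \<Rightarrow> nat \<Rightarrow> nat"
  show "\<exists>g. \<forall>i\<in>f ` I. \<exists>\<^sub>F n in at_top. h i n < g n"
    using assms[unfolded small_def, rule_format, of "\<lambda>i. h (f i)"] by auto
qed

lemma small_empty: "small {}"
  unfolding small_def by simp

lemma small_singleton: "small {x}"
  unfolding small_def
proof
  fix h :: "'a \<Rightarrow> nat \<Rightarrow> nat"
  show "\<exists>g. \<forall>i\<in>{x}. \<exists>\<^sub>F n in at_top. h i n < g n"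
    by (rule exI[of _ "\<lambda>n. Suc (h x n)"]) simp
qed

text \<open>Diagonal argument: the sum over \<open>k \<le> n\<close> of \<open>g k n\<close> is at
  least \<open>g k n\<close> as soon as \<open>n \<ge> k\<close>, so one function escapes all the
  families at once.\<close>

lemma small_UN_nat:
  assumes "\<And>k::nat. small (I k)" shows "small (\<Union>k. I k)"
  unfolding small_def
proof
  fix h :: "'a \<Rightarrow> nat \<Rightarrow> nat"
  have "\<forall>k. \<exists>g. \<forall>i\<in>I k. \<exists>\<^sub>F n in at_top. h i n < g n"
    using assms unfolding small_def by blast
  then obtain g where g: "\<And>k i. i \<in> I k \<Longrightarrow> \<exists>\<^sub>F n in at_top. h i n < g k n"
    by metis
  have "\<exists>\<^sub>F n in at_top. h i n < (\<Sum>k\<le>n. g k n)" if "i \<in> I k" for i k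
  proof -
    have "\<forall>\<^sub>F n in at_top. g k n \<le> (\<Sum>k\<le>n. g k n)"
      using eventually_ge_at_top[of k]
      by eventually_elim (rule member_le_sum, auto)
    then show ?thesis
      using g[OF that] by (auto elim: frequently_rev_mp elim!: eventually_mono)
  qed
  then show "\<exists>g. \<forall>i\<in>\<Union>k. I k. \<exists>\<^sub>F n in at_top. h i n < g n"
    by (intro exI[of _ "\<lambda>n. \<Sum>k\<le>n. g k n"]) auto
qed

lemma small_countable:
  assumes "countable I" shows "small I"
proof (cases "I = {}")
  case False
  have "small (\<Union>k. {from_nat_into I k})"
    by (intro small_UN_nat small_singleton)
  then show ?thesis
    using range_from_nat_into[OF False assms] by (simp only: UNION_singleton_eq_range)
qed (simp add: small_empty)

lemma small_Un:
  assumes "small I" "small J" shows "small (I \<union> J)"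
proof -
  define K where "K k = (if k = 0 then I else J)" for k :: nat
  have "small (\<Union>k. K k)"
    using assms by (intro small_UN_nat) (simp add: K_def)
  moreover have "I = K 0" "J = K 1"
    by (simp_all add: K_def)
  then have "I \<union> J \<subseteq> (\<Union>k. K k)"
    by blast
  ultimately show ?thesis by (rule small_subset)
qed

lemma small_Times_self:
  assumes "small I" shows "small (I \<times> I)"
proof (cases "finite I")
  case True
  then show ?thesis by (intro small_countable countable_finite) auto
next
  case False
  then obtain f where "bij_betw f I (I \<times> I)"
    using card_of_Times_same_infinite card_of_ordIso ordIso_symmetric by metis
  then show ?thesis
    using small_image[OF assms, of f] by (simp add: bij_betw_imp_surj_on)
qed

text \<open>The disjoint sum brings both index sets into one type, where the product is covered by
  an image of a square.\<close>

lemma small_Times: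
  assumes "small I" "small J" shows "small (I \<times> J)"
proof -
  let ?K = "Inl ` I \<union> Inr ` J"
  have "small (?K \<times> ?K)"
    using assms by (intro small_Times_self small_Un small_image)
  then have "small ((\<lambda>(a, b). (projl a, projr b)) ` (?K \<times> ?K))"
    by (rule small_image)
  moreover have "I \<times> J \<subseteq> (\<lambda>(a, b). (projl a, projr b)) ` (?K \<times> ?K)"
  proof clarify
    fix i j assume "i \<in> I" "j \<in> J"
    then have "(Inl i, Inr j) \<in> ?K \<times> ?K" by blast
    then show "(i, j) \<in> (\<lambda>(a, b). (projl a, projr b)) ` (?K \<times> ?K)"
      by (rule rev_image_eqI) simp
  qed
  ultimately show ?thesis by (rule small_subset)
qed

text \<open>Lists stand for finite subsets of \<open>I\<close>. Those of a fixed length are handled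
  by products, and there are countably many lengths.\<close>

lemma small_lists:
  assumes "small I" shows "small (lists I)"
proof -
  have "small {xs \<in> lists I. length xs = n}" for n
  proof (induction n)
    case 0
    have "{xs \<in> lists I. length xs = 0} \<subseteq> {[]}" by auto
    then show ?case by (rule small_subset[OF small_singleton])
  next
    case (Suc n)
    have "{xs \<in> lists I. length xs = Suc n}
        \<subseteq> (\<lambda>(x, xs). x # xs) ` (I \<times> {xs \<in> lists I. length xs = n})"
      by (auto simp: length_Suc_conv image_iff)
    then show ?case
      by (rule small_subset[OF small_image[OF small_Times[OF assms Suc]]])
  qed
  then have "small (\<Union>n. {xs \<in> lists I. length xs = n})"
    by (rule small_UN_nat)
  then show ?thesis by (rule small_subset) auto
qed

section \<open>Filters with a base of size below d\<close>

definition small_base :: "'a filter \<Rightarrow> 'a set set \<Rightarrow> bool" where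
  "small_base F \<B> \<longleftrightarrow> small \<B> \<and> (\<forall>P. eventually P F \<longleftrightarrow> (\<exists>B\<in>\<B>. \<forall>x\<in>B. P x))"

definition small_filter :: "'a filter \<Rightarrow> bool" where
  "small_filter F \<longleftrightarrow> (\<exists>\<B>. small_base F \<B>)"

lemma small_filter_filtermap:
  assumes "small_filter F" shows "small_filter (filtermap f F)"
proof -
  obtain \<B> where "small_base F \<B>"
    using assms unfolding small_filter_def by blast
  then have "small_base (filtermap f F) ((`) f ` \<B>)"
    unfolding small_base_def by (auto simp: eventually_filtermap small_image)
  then show ?thesis unfolding small_filter_def by blast
qed

lemma small_filter_inf:
  assumes "small_filter F" "small_filter G" shows "small_filter (inf F G)"
proof -
  obtain \<B> \<C> where B: "small_base F \<B>" and C: "small_base G \<C>"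
    using assms unfolding small_filter_def by blast
  have "(\<exists>B\<in>\<B>. \<exists>C\<in>\<C>. \<forall>x\<in>B \<inter> C. P x) \<longleftrightarrow> eventually P (inf F G)" for P
  proof
    assume "\<exists>B\<in>\<B>. \<exists>C\<in>\<C>. \<forall>x\<in>B \<inter> C. P x"
    then obtain B' C' where BC: "B' \<in> \<B>" "C' \<in> \<C>" "\<forall>x\<in>B' \<inter> C'. P x" by blast
    then have "eventually (\<lambda>x. x \<in> B') F" "eventually (\<lambda>x. x \<in> C') G"
      using B C unfolding small_base_def by blast+
    with BC(3) show "eventually P (inf F G)"
      unfolding eventually_inf by blast
  next
    assume "eventually P (inf F G)"
    then show "\<exists>B\<in>\<B>. \<exists>C\<in>\<C>. \<forall>x\<in>B \<inter> C. P x"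
      using B C unfolding eventually_inf small_base_def by (metis Int_iff)
  qed
  then have "small_base (inf F G) ((\<lambda>(B, C). B \<inter> C) ` (\<B> \<times> \<C>))"
    using B C unfolding small_base_def
    by (auto intro!: small_image small_Times)
  then show ?thesis unfolding small_filter_def by blast
qed

lemma small_filter_at_top: "small_filter (at_top :: nat filter)"
proof -
  have "small_base at_top (range (\<lambda>n::nat. {n..}))"
    unfolding small_base_def
    by (auto simp: eventually_at_top_linorder intro!: small_countable)
  then show ?thesis unfolding small_filter_def by blast
qed

lemma small_filter_principal: "small_filter (principal A)"
proof -
  have "small_base (principal A) {A}"
    unfolding small_base_def by (simp add: small_singleton eventually_principal)
  then show ?thesis unfolding small_filter_def by blast
qed

text \<open>The finite intersections of the generators form a base, and lists of indices enumerate
  them.\<close>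

lemma small_filter_INF_principal:
  assumes "small I" shows "small_filter (INF i\<in>I. principal (A i))"
proof -
  have "eventually P (INF i\<in>I. principal (A i)) \<longleftrightarrow>
      (\<exists>xs\<in>lists I. \<forall>x\<in>(\<Inter>i\<in>set xs. A i). P x)" for P
  proof -
    have "eventually P (INF i\<in>I. principal (A i)) \<longleftrightarrow>
        (\<exists>X\<subseteq>I. finite X \<and> eventually P (principal (\<Inter>i\<in>X. A i)))"
      by (subst eventually_INF) (simp add: INF_principal_finite cong: conj_cong)
    also have "\<dots> \<longleftrightarrow> (\<exists>xs\<in>lists I. \<forall>x\<in>(\<Inter>i\<in>set xs. A i). P x)"
    proof
      assume "\<exists>X\<subseteq>I. finite X \<and> eventually P (principal (\<Inter>i\<in>X. A i))"
      then obtain X where X: "X \<subseteq> I" "finite X" "\<forall>x\<in>(\<Inter>i\<in>X. A i). P x"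
        unfolding eventually_principal by blast
      obtain xs where "set xs = X" using finite_list[OF X(2)] by blast
      with X show "\<exists>xs\<in>lists I. \<forall>x\<in>(\<Inter>i\<in>set xs. A i). P x"
        by (intro bexI[of _ xs]) auto
    next
      assume "\<exists>xs\<in>lists I. \<forall>x\<in>(\<Inter>i\<in>set xs. A i). P x"
      then obtain xs where "xs \<in> lists I" "\<forall>x\<in>(\<Inter>i\<in>set xs. A i). P x" by blast
      then show "\<exists>X\<subseteq>I. finite X \<and> eventually P (principal (\<Inter>i\<in>X. A i))"
        unfolding eventually_principal by (intro exI[of _ "set xs"]) auto
    qed
    finally show ?thesis .
  qed
  then have "small_base (INF i\<in>I. principal (A i)) ((\<lambda>xs. \<Inter>i\<in>set xs. A i) ` lists I)"
    using assms unfolding small_base_def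
    by (auto intro!: small_image small_lists)
  then show ?thesis unfolding small_filter_def by blast
qed

section \<open>Block maps, splitting and near coherence\<close>

text \<open>Iterating a strictly increasing majorant \<open>k\<close> of \<open>h\<close> from 0
  cuts \<omega> into intervals, which \<psi> numbers. Since \<open>k\<close> maps every point below
  an endpoint to a point below the next endpoint, \<open>h\<close> leads at most into the next
  block.\<close>

lemma exists_block_map:
  fixes h :: "nat \<Rightarrow> nat"
  shows "\<exists>\<psi> :: nat \<Rightarrow> nat. mono \<psi> \<and> filterlim \<psi> at_top at_top \<and> (\<forall>n. \<psi> (h n) \<le> Suc (\<psi> n))"
proof -
  define k where "k n = Suc (n + (\<Sum>i\<le>n. h i))" for n
  have k: "strict_mono k" "n < k n" "h n \<le> k n" for n
  proof -
    show "strict_mono k"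
      by (rule strict_monoI_Suc) (simp add: k_def)
    show "n < k n" by (simp add: k_def)
    have "h n \<le> (\<Sum>i\<le>n. h i)" by (rule member_le_sum) auto
    then show "h n \<le> k n" by (simp add: k_def)
  qed
  define t where "t i = (k ^^ i) 0" for i
  have t: "strict_mono t"
    by (rule strict_monoI_Suc) (simp add: t_def k)
  define \<psi> where "\<psi> n = (LEAST i. n < t i)" for n
  have ex: "n < t (Suc n)" for n
    using strict_mono_imp_increasing[OF t, of "Suc n"] by simp
  have lt: "n < t (\<psi> n)" for n
    unfolding \<psi>_def by (rule LeastI) (rule ex)
  have le: "\<psi> n \<le> i" if "n < t i" for n i
    unfolding \<psi>_def using that by (rule Least_le)
  show ?thesis
  proof (intro exI conjI allI)
    show "mono \<psi>"
      by (intro monoI le) (rule le_less_trans[OF _ lt])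
    show "filterlim \<psi> at_top at_top"
      unfolding filterlim_at_top
    proof
      fix i
      have "i \<le> \<psi> n" if "t i \<le> n" for n
        using strict_mono_less[OF t, of i "\<psi> n"] lt[of n] that by linarith
      then show "\<forall>\<^sub>F n in at_top. i \<le> \<psi> n"
        unfolding eventually_at_top_linorder by blast
    qed
    show "\<psi> (h n) \<le> Suc (\<psi> n)" for n
    proof (rule le)
      have "k n < k (t (\<psi> n))"
        using lt k(1) by (rule strict_monoD[rotated])
      then show "h n < t (Suc (\<psi> n))"
        using k(3)[of n] by (simp add: t_def)
    qed
  qed
qed

text \<open>If the two image filters are coherent, their infimum is proper, free and has a small
  base, so by hypothesis some \<open>S\<close> is undecided by it. Then neither image filter
  contains the wrong side of \<open>S\<close>, so \<open>F\<close> can be restricted to the preimage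
  of \<open>S\<close> and \<open>G\<close> to the preimage of its complement, which separates the
  images.\<close>

lemma split_near_coherence:
  fixes F G :: "nat filter"
  assumes no_small_ultra: "\<And>H :: nat filter. small_filter H \<Longrightarrow> H \<noteq> bot \<Longrightarrow> H \<le> at_top \<Longrightarrow>
      \<exists>S. \<not> eventually (\<lambda>n. n \<in> S) H \<and> \<not> eventually (\<lambda>n. n \<notin> S) H"
    and F: "small_filter F" "F \<noteq> bot" "F \<le> at_top"
    and G: "small_filter G" "G \<noteq> bot" "G \<le> at_top"
    and \<phi>: "filterlim (\<phi> :: nat \<Rightarrow> nat) at_top at_top"
  shows "\<exists>A C. inf F (principal A) \<noteq> bot \<and> inf G (principal C) \<noteq> bot \<and>
    inf (filtermap \<phi> (inf F (principal A))) (filtermap \<phi> (inf G (principal C))) = bot"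
proof (cases "inf (filtermap \<phi> F) (filtermap \<phi> G) = bot")
  case True
  then show ?thesis
    using F(2) G(2) by (intro exI[of _ UNIV]) simp
next
  case False
  let ?H = "inf (filtermap \<phi> F) (filtermap \<phi> G)"
  have "filtermap \<phi> F \<le> at_top"
    using filtermap_mono[OF F(3), of \<phi>] \<phi> unfolding filterlim_def by (rule order_trans)
  then have "?H \<le> at_top" by (simp add: le_infI1)
  then obtain S where S: "\<not> eventually (\<lambda>n. n \<in> S) ?H" "\<not> eventually (\<lambda>n. n \<notin> S) ?H"
    using no_small_ultra[OF small_filter_inf[OF small_filter_filtermap[OF F(1)]
          small_filter_filtermap[OF G(1)]] False] by blast
  define A where "A = \<phi> -` S"
  define C where "C = \<phi> -` (- S)"
  have "inf F (principal A) \<noteq> bot"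
  proof
    assume "inf F (principal A) = bot"
    then have "eventually (\<lambda>n. n \<notin> S) (filtermap \<phi> F)"
      by (simp add: trivial_limit_def eventually_inf_principal eventually_filtermap A_def)
    with S(2) show False using filter_leD[OF inf_le1] by fast
  qed
  moreover have "inf G (principal C) \<noteq> bot"
  proof
    assume "inf G (principal C) = bot"
    then have "eventually (\<lambda>n. n \<in> S) (filtermap \<phi> G)"
      by (simp add: trivial_limit_def eventually_inf_principal eventually_filtermap C_def)
    with S(1) show False using filter_leD[OF inf_le2] by fast
  qed
  moreover have "inf (filtermap \<phi> (inf F (principal A))) (filtermap \<phi> (inf G (principal C))) = bot"
  proof -
    have "eventually (\<lambda>n. n \<in> S) (filtermap \<phi> (inf F (principal A)))"
      "eventually (\<lambda>n. n \<notin> S) (filtermap \<phi> (inf G (principal C)))"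
      by (simp_all add: eventually_filtermap eventually_inf_principal A_def C_def)
    then show ?thesis unfolding trivial_limit_def eventually_inf by blast
  qed
  ultimately show ?thesis by blast
qed

text \<open>A proper filter that contains all final segments is not \<open>principal A\<close>: the
  final segment beyond an element of \<open>A\<close> would have to include \<open>A\<close>. So NCF
  applies, and it is used on one image from each filter.\<close>

lemma NCF_nearly_coherent:
  fixes F G :: "nat filter"
  assumes NCF and F: "F \<noteq> bot" "F \<le> at_top" and G: "G \<noteq> bot" "G \<le> at_top"
  obtains \<phi> :: "nat \<Rightarrow> nat" where "mono \<phi>" "surj \<phi>"
    "\<And>U V. eventually (\<lambda>n. n \<in> U) F \<Longrightarrow> eventually (\<lambda>n. n \<in> V) G \<Longrightarrow> \<exists>u\<in>U. \<exists>v\<in>V. \<phi> u = \<phi> v"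
proof -
  have np: "nonprincipal H" if "H \<noteq> bot" "H \<le> at_top" for H :: "nat filter"
    unfolding nonprincipal_def
  proof (intro allI notI)
    fix A assume H: "H = principal A"
    with that obtain a where "a \<in> A" by (auto simp: principal_eq_bot_iff)
    have "eventually (\<lambda>n. Suc a \<le> n) H"
      using that(2) eventually_ge_at_top by (rule filter_leD)
    then have "\<forall>x\<in>A. Suc a \<le> x"
      by (simp add: H eventually_principal)
    with \<open>a \<in> A\<close> have "Suc a \<le> a" by (rule bspec[rotated])
    then show False by simp
  qed
  obtain \<phi> :: "nat \<Rightarrow> nat" where \<phi>: "mono \<phi>" "surj \<phi>"
    and c: "centered (image_sets \<phi> F \<union> image_sets \<phi> G)"
    using \<open>NCF\<close>[unfolded NCF_def, rule_format, OF conjI[OF np[OF F] np[OF G]]] by (elim exE conjE)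
  show thesis
  proof (rule that[OF \<phi>])
    fix U V assume "eventually (\<lambda>n. n \<in> U) F" "eventually (\<lambda>n. n \<in> V) G"
    then have "infinite (\<Inter>{\<phi> ` U, \<phi> ` V})"
      by (intro c[unfolded centered_def, rule_format]) (auto simp: image_sets_def)
    then have "\<phi> ` U \<inter> \<phi> ` V \<noteq> {}" by auto
    then show "\<exists>u\<in>U. \<exists>v\<in>V. \<phi> u = \<phi> v" by blast
  qed
qed

text \<open>By monotonicity a point of the next fibre lies beyond the whole fibre of
  \<open>n\<close>. The function \<open>e\<close> thus bounds the fibres and can be compared with a
  dominating family.\<close>

lemma exists_next_fibre:
  assumes "mono \<phi>" "surj (\<phi> :: nat \<Rightarrow> nat)"
  obtains e :: "nat \<Rightarrow> nat" where "\<And>n. \<phi> (e n) = Suc (\<phi> n)"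
    "\<And>m n. \<phi> m = \<phi> n \<Longrightarrow> m < e n"
proof -
  have "\<forall>n. \<exists>m. \<phi> m = Suc (\<phi> n)" using assms(2) unfolding surj_def by metis
  from choice[OF this] obtain e where e: "\<And>n. \<phi> (e n) = Suc (\<phi> n)" by blast
  moreover have "m < e n" if "\<phi> m = \<phi> n" for m n
    using monoD[OF assms(1), of "e n" m] e[of n] that by (cases "m < e n") auto
  ultimately show thesis using that by blast
qed

section \<open>Recursion along a dominating family: an ultrafilter with a small base\<close>

text \<open>Stands in for the initial ordinal of d: a well-ordered dominating index set all of whose proper
  initial segments are small.\<close>
lemma minimal_nonsmall:
  obtains J :: "(nat \<Rightarrow> nat) set" and R where "wf R" "trans R" "total R" "\<not> small J"
    "\<And>i. i \<in> J \<Longrightarrow> small {j\<in>J. (j, i) \<in> R}"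
proof -
  obtain r :: "(nat \<Rightarrow> nat) rel" where r: "well_order_on UNIV r"
    using well_order_on by blast
  define R where "R = r - Id"
  have R: "wf R" "total R" "trans R"
    using r unfolding well_order_on_def linear_order_on_def partial_order_on_def preorder_on_def R_def
    by (auto simp: total_on_diff_Id trans_diff_Id)
  \<comment> \<open>A function not dominated by any function would have to exceed itself
    somewhere.\<close>
  have nonsmall: "\<not> small (UNIV :: (nat \<Rightarrow> nat) set)"
  proof
    assume "small (UNIV :: (nat \<Rightarrow> nat) set)"
    then obtain g :: "nat \<Rightarrow> nat" where "\<forall>i. \<exists>\<^sub>F n in at_top. i n < g n"
      unfolding small_def by (elim allE[of _ "\<lambda>i. i"]) auto
    then have "\<exists>\<^sub>F n in at_top. g n < g n" by (rule spec)
    then show False by simp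
  qed
  show thesis
  \<comment> \<open>Either cut at the least point whose initial segment is not small, or take the
    whole type when there is no such point.\<close>
  proof (cases "\<exists>i. \<not> small {j. (j, i) \<in> R}")
    case True
    then obtain i0 where "i0 \<in> {i. \<not> small {j. (j, i) \<in> R}}" by blast
    from wfE_min[OF R(1) this] obtain i where i: "\<not> small {j. (j, i) \<in> R}"
      and "\<And>k. (k, i) \<in> R \<Longrightarrow> k \<notin> {i. \<not> small {j. (j, i) \<in> R}}" by (metis mem_Collect_eq)
    then have min: "small {j. (j, k) \<in> R}" if "(k, i) \<in> R" for k
      using that by simp
    show thesis
    proof (rule that[OF R(1) R(3) R(2) i])
      fix k assume "k \<in> {j. (j, i) \<in> R}"
      then have "small {j. (j, k) \<in> R}" by (simp add: min)
      then show "small {j \<in> {j. (j, i) \<in> R}. (j, k) \<in> R}"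
        by (rule small_subset) blast
    qed
  next
    case False
    show thesis
      by (rule that[OF R(1) R(3) R(2) nonsmall]) (use False in simp)
  qed
qed

text \<open>Only finitely many generators are involved in a failure. The filter at the stage of the
  largest of their indices, with its own generator added, refines all of them and is proper by
  assumption.\<close>

lemma chain_filter_not_bot:
  fixes A :: "'i \<Rightarrow> nat set"
  assumes "trans R" "total R"
    and step: "\<And>i. i \<in> K \<Longrightarrow>
      inf (inf at_top (INF j\<in>{j\<in>K. (j, i) \<in> R}. principal (A j))) (principal (A i)) \<noteq> bot"
  shows "inf at_top (INF i\<in>K. principal (A i)) \<noteq> bot"
proof
  assume bot: "inf at_top (INF i\<in>K. principal (A i)) = bot"
  obtain P Q where P: "eventually P at_top" and Q: "eventually Q (INF i\<in>K. principal (A i))"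
    and PQ: "\<And>x. P x \<Longrightarrow> Q x \<Longrightarrow> False"
    using bot unfolding trivial_limit_def eventually_inf by blast
  obtain X where X: "X \<subseteq> K" "finite X" and QX: "eventually Q (INF i\<in>X. principal (A i))"
    using eventually_INF[THEN iffD1, OF Q] by blast
  have X_bot: "inf at_top (INF i\<in>X. principal (A i)) = bot"
    using P QX PQ unfolding trivial_limit_def eventually_inf by blast
  show False
  proof (cases "X = {}")
    case True
    with X_bot show False by simp
  next
    case False
    have "\<exists>i\<in>X. \<forall>j\<in>X. j = i \<or> (j, i) \<in> R"
      using X(2) False
    proof (induction rule: finite_ne_induct)
      case (insert x F)
      then obtain i where i: "i \<in> F" "\<forall>j\<in>F. j = i \<or> (j, i) \<in> R" by blast
      have "x = i \<or> (x, i) \<in> R \<or> (i, x) \<in> R"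
        using \<open>total R\<close> by (auto simp: total_on_def)
      then show ?case
      proof (elim disjE)
        assume "(i, x) \<in> R"
        then have "\<forall>j\<in>F. (j, x) \<in> R"
          using i(2) \<open>trans R\<close> by (auto dest: transD)
        then show ?thesis by blast
      qed (use i in blast)+
    qed simp
    then obtain i where i: "i \<in> X" "\<And>j. j \<in> X \<Longrightarrow> j = i \<or> (j, i) \<in> R" by blast
    have "inf (inf at_top (INF j\<in>{j\<in>K. (j, i) \<in> R}. principal (A j))) (principal (A i))
        \<le> inf at_top (INF i\<in>X. principal (A i))"
    proof (intro inf_greatest INF_greatest)
      fix j assume "j \<in> X"
      with i(2) X(1) consider "j = i" | "j \<in> {j\<in>K. (j, i) \<in> R}" by blast
      then show "inf (inf at_top (INF j\<in>{j\<in>K. (j, i) \<in> R}. principal (A j))) (principal (A i))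
          \<le> principal (A j)"
      proof cases
        case 2
        then show ?thesis by (intro le_infI1 le_infI2 INF_lower)
      qed simp
    qed (simp add: le_infI1)
    with X_bot step[of i] i(1) X(1) show False
      by (simp add: bot_unique subset_iff)
  qed
qed

text \<open>Splitting for \<open>\<phi>\<close> and then for \<open>\<phi>'\<close> suffices,
  because further refinement keeps the images under \<open>\<phi>\<close> separated.\<close>

lemma split_near_coherence2:
  fixes F G :: "nat filter"
  assumes no_small_ultra: "\<And>H :: nat filter. small_filter H \<Longrightarrow> H \<noteq> bot \<Longrightarrow> H \<le> at_top \<Longrightarrow>
      \<exists>S. \<not> eventually (\<lambda>n. n \<in> S) H \<and> \<not> eventually (\<lambda>n. n \<notin> S) H"
    and F: "small_filter F" "F \<noteq> bot" "F \<le> at_top"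
    and G: "small_filter G" "G \<noteq> bot" "G \<le> at_top"
    and \<phi>: "filterlim (\<phi> :: nat \<Rightarrow> nat) at_top at_top" "filterlim (\<phi>' :: nat \<Rightarrow> nat) at_top at_top"
  shows "\<exists>A C. inf F (principal A) \<noteq> bot \<and> inf G (principal C) \<noteq> bot \<and>
    inf (filtermap \<phi> (inf F (principal A))) (filtermap \<phi> (inf G (principal C))) = bot \<and>
    inf (filtermap \<phi>' (inf F (principal A))) (filtermap \<phi>' (inf G (principal C))) = bot"
proof -
  obtain A C where AC: "inf F (principal A) \<noteq> bot" "inf G (principal C) \<noteq> bot"
    "inf (filtermap \<phi> (inf F (principal A))) (filtermap \<phi> (inf G (principal C))) = bot"
    using split_near_coherence[OF no_small_ultra F G \<phi>(1)] by blast
  have F': "small_filter (inf F (principal A))" "inf F (principal A) \<le> at_top"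
    and G': "small_filter (inf G (principal C))" "inf G (principal C) \<le> at_top"
    using F G by (auto intro: small_filter_inf small_filter_principal le_infI1)
  obtain A' C' where AC': "inf (inf F (principal A)) (principal A') \<noteq> bot"
    "inf (inf G (principal C)) (principal C') \<noteq> bot"
    "inf (filtermap \<phi>' (inf (inf F (principal A)) (principal A')))
      (filtermap \<phi>' (inf (inf G (principal C)) (principal C'))) = bot"
    using split_near_coherence[OF no_small_ultra F'(1) AC(1) F'(2) G'(1) AC(2) G'(2) \<phi>(2)] by blast
  have eq: "inf (inf F (principal A)) (principal A') = inf F (principal (A \<inter> A'))"
    "inf (inf G (principal C)) (principal C') = inf G (principal (C \<inter> C'))"
    by (simp_all add: inf_assoc)
  have "inf (filtermap \<phi> (inf F (principal (A \<inter> A')))) (filtermap \<phi> (inf G (principal (C \<inter> C'))))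
      \<le> inf (filtermap \<phi> (inf F (principal A))) (filtermap \<phi> (inf G (principal C)))"
    by (intro inf_mono filtermap_mono order_refl) auto
  then have "inf (filtermap \<phi> (inf F (principal (A \<inter> A')))) (filtermap \<phi> (inf G (principal (C \<inter> C')))) = bot"
    unfolding AC(3) by (rule bot_unique[THEN iffD1])
  with AC'[unfolded eq] show ?thesis by blast
qed

lemma inf_filtermap_eq_bot:
  assumes "inf (filtermap f F) (filtermap f G) = bot"
  obtains U V where "eventually (\<lambda>x. x \<in> U) F" "eventually (\<lambda>x. x \<in> V) G"
    "\<And>u v. u \<in> U \<Longrightarrow> v \<in> V \<Longrightarrow> f u \<noteq> f v"
proof -
  obtain P Q where "eventually P (filtermap f F)" "eventually Q (filtermap f G)"
    and PQ: "\<forall>x. P x \<and> Q x \<longrightarrow> False"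
    using assms unfolding trivial_limit_def eventually_inf by blast
  then show thesis
    by (intro that[of "{x. P (f x)}" "{x. Q (f x)}"]) (auto simp: eventually_filtermap)
qed

text \<open>Suppose there is no such ultrafilter. Stage \<open>i\<close> of the recursion adds sets
  that separate the two filters built so far under \<open>\<phi> i\<close> and
  \<open>\<phi>' i\<close>. NCF makes the final filters coherent under some \<open>\<theta>\<close>,
  whose fibre bound \<open>e\<close> is eventually below some \<open>h i\<close>; coherent points
  then lie in equal or adjacent blocks of \<open>\<psi> i\<close>, against stage
  \<open>i\<close>.\<close>

theorem NCF_small_ultrafilter:
  assumes NCF
  obtains H :: "nat filter" where "small_filter H" "H \<noteq> bot" "H \<le> at_top"
    "\<And>S. eventually (\<lambda>n. n \<in> S) H \<or> eventually (\<lambda>n. n \<notin> S) H"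
proof (rule ccontr)
  assume "\<not> thesis"
  with that have no_small_ultra: "\<And>H :: nat filter. small_filter H \<Longrightarrow> H \<noteq> bot \<Longrightarrow> H \<le> at_top \<Longrightarrow>
      \<exists>S. \<not> eventually (\<lambda>n. n \<in> S) H \<and> \<not> eventually (\<lambda>n. n \<notin> S) H" by blast
  obtain R and J :: "(nat \<Rightarrow> nat) set" where R: "wf R" "trans R" "total R" and J: "\<not> small J"
    and seg: "\<And>i. i \<in> J \<Longrightarrow> small {j\<in>J. (j, i) \<in> R}"
    by (rule minimal_nonsmall) (rule that)
  obtain h :: "(nat \<Rightarrow> nat) \<Rightarrow> nat \<Rightarrow> nat"
    where h: "\<And>g. \<exists>i\<in>J. \<forall>\<^sub>F n in at_top. g n \<le> h i n"
    by (rule not_small_dominating[OF J]) (rule that)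
  have "\<forall>i. \<exists>\<psi>. mono \<psi> \<and> filterlim \<psi> at_top at_top \<and> (\<forall>n. \<psi> (h i n) \<le> Suc (\<psi> n))"
    by (rule allI) (rule exists_block_map)
  from choice[OF this] obtain \<psi> where \<psi>: "\<And>i. mono (\<psi> i)"
    "\<And>i. filterlim (\<psi> i :: nat \<Rightarrow> nat) at_top at_top"
    "\<And>i n. \<psi> i (h i n) \<le> Suc (\<psi> i n)"
    by blast
  define seg where "seg i = {j\<in>J. (j, i) \<in> R}" for i
  define gen where "gen A K = inf at_top (INF i\<in>K. principal (A i))"
    for A :: "(nat \<Rightarrow> nat) \<Rightarrow> nat set" and K
  \<comment> \<open>Indices in equal or adjacent blocks of \<open>\<psi> i\<close> are identified by \<open>\<phi> i\<close> or by \<open>\<phi>' i\<close>.\<close>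
  define \<phi> where "\<phi> i n = \<psi> i n div 2" for i n
  define \<phi>' where "\<phi>' i n = Suc (\<psi> i n) div 2" for i n
  have lim: "filterlim (\<phi> i) at_top at_top" "filterlim (\<phi>' i) at_top at_top" for i
  proof -
    have "filterlim (\<lambda>n::nat. n div 2) at_top at_top" "filterlim (\<lambda>n. Suc n div 2) at_top at_top"
      unfolding filterlim_at_top eventually_at_top_linorder by presburger+
    then show "filterlim (\<phi> i) at_top at_top" "filterlim (\<phi>' i) at_top at_top"
      unfolding \<phi>_def \<phi>'_def using \<psi>(2) by (auto intro: filterlim_compose)
  qed
  define separates where "separates i F G A C \<longleftrightarrow>
      inf F (principal A) \<noteq> bot \<and> inf G (principal C) \<noteq> bot \<and>
      inf (filtermap (\<phi> i) (inf F (principal A))) (filtermap (\<phi> i) (inf G (principal C))) = bot \<and>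
      inf (filtermap (\<phi>' i) (inf F (principal A))) (filtermap (\<phi>' i) (inf G (principal C))) = bot"
    for i F G A C
  \<comment> \<open>The implication makes a choice possible at every index, vacuously if a filter
    has become improper. That this never happens is proved after the recursion.\<close>
  define step where "step f i r \<longleftrightarrow>
      (i \<in> J \<and> gen (\<lambda>j. fst (f j)) (seg i) \<noteq> bot \<and> gen (\<lambda>j. snd (f j)) (seg i) \<noteq> bot \<longrightarrow>
       separates i (gen (\<lambda>j. fst (f j)) (seg i)) (gen (\<lambda>j. snd (f j)) (seg i)) (fst r) (snd r))"
    for f :: "(nat \<Rightarrow> nat) \<Rightarrow> nat set \<times> nat set" and i r
  have "\<exists>f. \<forall>i. step f i (f i)"
  proof (rule dependent_wf_choice[OF R(1)])
    fix f g :: "(nat \<Rightarrow> nat) \<Rightarrow> nat set \<times> nat set" and i r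
    assume "\<And>j. (j, i) \<in> R \<Longrightarrow> f j = g j"
    then have "gen (\<lambda>j. fst (f j)) (seg i) = gen (\<lambda>j. fst (g j)) (seg i)"
      "gen (\<lambda>j. snd (f j)) (seg i) = gen (\<lambda>j. snd (g j)) (seg i)"
      unfolding gen_def seg_def by (auto intro!: arg_cong[where f = "inf at_top"] INF_cong)
    then show "step f i r = step g i r" unfolding step_def by simp
  next
    fix i and f :: "(nat \<Rightarrow> nat) \<Rightarrow> nat set \<times> nat set"
    let ?F = "gen (\<lambda>j. fst (f j)) (seg i)" and ?G = "gen (\<lambda>j. snd (f j)) (seg i)"
    show "\<exists>r. step f i r"
    proof (cases "i \<in> J \<and> ?F \<noteq> bot \<and> ?G \<noteq> bot")
      case True
      have "small (seg i)" using True seg unfolding seg_def by blast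
      then have "small_filter ?F" "small_filter ?G"
        unfolding gen_def
        by (auto intro!: small_filter_inf small_filter_at_top small_filter_INF_principal)
      moreover have "?F \<le> at_top" "?G \<le> at_top" unfolding gen_def by auto
      ultimately obtain A C where "separates i ?F ?G A C"
        using split_near_coherence2[OF no_small_ultra, of ?F ?G "\<phi> i" "\<phi>' i"] True lim
        unfolding separates_def by blast
      then show ?thesis unfolding step_def by (intro exI[of _ "(A, C)"]) simp
    qed (auto simp: step_def)
  qed
  then obtain f where f: "\<And>i. step f i (f i)" by blast
  define A where "A i = fst (f i)" for i
  define C where "C i = snd (f i)" for i
  have sep: "separates i (gen A (seg i)) (gen C (seg i)) (A i) (C i)"
    if "i \<in> J" "gen A (seg i) \<noteq> bot" "gen C (seg i) \<noteq> bot" for i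
    using f[of i] that unfolding step_def A_def C_def by blast
  have seg_trans: "{k \<in> seg i. (k, j) \<in> R} = seg j" if "j \<in> seg i" for i j
    using that R(2) unfolding seg_def by (auto dest: transD)
  \<comment> \<open>Separation at each earlier stage includes properness of the extended filters,
    which is what the chain lemma requires along the segment below \<open>i\<close>.\<close>
  have not_bot: "gen A (seg i) \<noteq> bot \<and> gen C (seg i) \<noteq> bot" for i
    using R(1)
  proof (induction i)
    case (less i)
    have *: "inf (gen A (seg j)) (principal (A j)) \<noteq> bot \<and> inf (gen C (seg j)) (principal (C j)) \<noteq> bot"
      if "j \<in> seg i" for j
      using sep[of j] less[of j] that unfolding separates_def by (simp add: seg_def)
    show ?case
      unfolding gen_def
      by (intro conjI chain_filter_not_bot[OF R(2,3)]) (simp_all add: seg_trans *[unfolded gen_def])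
  qed
  have sep: "separates i (gen A (seg i)) (gen C (seg i)) (A i) (C i)" if "i \<in> J" for i
    using sep that not_bot by blast
  let ?F = "gen A J" and ?G = "gen C J"
  have FG: "?F \<noteq> bot" "?G \<noteq> bot"
    unfolding gen_def
    by (rule chain_filter_not_bot[OF R(2,3)];
        use sep in \<open>force simp: separates_def gen_def seg_def\<close>)+
  have FG_top: "?F \<le> at_top" "?G \<le> at_top" unfolding gen_def by auto
  obtain \<theta> :: "nat \<Rightarrow> nat" where \<theta>: "mono \<theta>" "surj \<theta>"
    and coh: "\<And>U V. eventually (\<lambda>n. n \<in> U) ?F \<Longrightarrow> eventually (\<lambda>n. n \<in> V) ?G \<Longrightarrow>
      \<exists>u\<in>U. \<exists>v\<in>V. \<theta> u = \<theta> v"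
    by (rule NCF_nearly_coherent[OF assms FG(1) FG_top(1) FG(2) FG_top(2)]) (rule that)
  obtain e where e: "\<And>m n. \<theta> m = \<theta> n \<Longrightarrow> m < e n"
    by (rule exists_next_fibre[OF \<theta>]) (rule that)
  obtain i where i: "i \<in> J" "\<forall>\<^sub>F n in at_top. e n \<le> h i n"
    using h by blast
  then obtain N where N: "\<And>n. N \<le> n \<Longrightarrow> e n \<le> h i n"
    unfolding eventually_at_top_linorder by blast
  \<comment> \<open>The final filters refine those of stage \<open>i\<close>, so the disjointness
    obtained there survives.\<close>
  have below_gen: "gen B J \<le> inf (gen B (seg i)) (principal (B i))" for B
    unfolding gen_def seg_def using i(1)
    by (intro inf_greatest[OF inf_mono[OF order_refl INF_superset_mono] le_infI2[OF INF_lower]]) auto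
  have below: "?F \<le> inf (gen A (seg i)) (principal (A i))"
    "?G \<le> inf (gen C (seg i)) (principal (C i))"
    by (rule below_gen)+
  obtain U V where UV: "eventually (\<lambda>x. x \<in> U) ?F" "eventually (\<lambda>x. x \<in> V) ?G"
    "\<And>u v. u \<in> U \<Longrightarrow> v \<in> V \<Longrightarrow> \<phi> i u \<noteq> \<phi> i v"
    using sep[OF i(1)] unfolding separates_def
    by (elim conjE inf_filtermap_eq_bot[of "\<phi> i"])
      (rule that[OF filter_leD[OF below(1)] filter_leD[OF below(2)]])
  obtain U' V' where UV': "eventually (\<lambda>x. x \<in> U') ?F" "eventually (\<lambda>x. x \<in> V') ?G"
    "\<And>u v. u \<in> U' \<Longrightarrow> v \<in> V' \<Longrightarrow> \<phi>' i u \<noteq> \<phi>' i v"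
    using sep[OF i(1)] unfolding separates_def
    by (elim conjE inf_filtermap_eq_bot[of "\<phi>' i"])
      (rule that[OF filter_leD[OF below(1)] filter_leD[OF below(2)]])
  have "eventually (\<lambda>n. n \<in> {N..}) ?F" "eventually (\<lambda>n. n \<in> {N..}) ?G"
    using filter_leD[OF FG_top(1)] filter_leD[OF FG_top(2)] by simp_all
  with UV UV' have "eventually (\<lambda>n. n \<in> U \<inter> U' \<inter> {N..}) ?F" "eventually (\<lambda>n. n \<in> V \<inter> V' \<inter> {N..}) ?G"
    by (simp_all add: eventually_conj_iff)
  from coh[OF this] obtain u v where uv: "u \<in> U" "u \<in> U'" "N \<le> u" "v \<in> V" "v \<in> V'" "N \<le> v" "\<theta> u = \<theta> v"
    by auto
  \<comment> \<open>The fibre of \<open>n\<close> lies below \<open>e n\<close>, hence below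
    \<open>h i n\<close>, which is at most one block ahead.\<close>
  have near: "\<psi> i m \<le> Suc (\<psi> i n)" if "\<theta> m = \<theta> n" "N \<le> n" for m n
  proof -
    have "m \<le> h i n" using e[OF that(1)] N[OF that(2)] by linarith
    from monoD[OF \<psi>(1) this] \<psi>(3) show ?thesis by (rule order_trans)
  qed
  have "\<psi> i u \<le> Suc (\<psi> i v)" "\<psi> i v \<le> Suc (\<psi> i u)"
    using near uv by simp_all
  then consider "\<psi> i u = \<psi> i v" | "\<psi> i u = Suc (\<psi> i v)" | "\<psi> i v = Suc (\<psi> i u)"
    by linarith
  \<comment> \<open>Two adjacent block numbers have the same half if the smaller is even; if it is
    odd, they have the same half after adding one.\<close>
  then have "\<phi> i u = \<phi> i v \<or> \<phi>' i u = \<phi>' i v"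
    unfolding \<phi>_def \<phi>'_def by cases (simp_all, linarith+)
  with UV(3) UV'(3) uv show False by blast
qed

text \<open>This turns coherence into bounds, with one \<open>e\<close> for all members of
  \<open>K\<close>. The saturation of \<open>A\<close> under the fibres of \<open>\<phi>\<close>
  belongs to \<open>H\<close>, as its complement would not be coherent with \<open>A\<close>. For
  \<open>q\<close> in it, a point \<open>m\<close> of \<open>A\<close> shares the fibre of
  \<open>q\<close>: it is below \<open>e q\<close>, and it is beyond every \<open>b\<close> with
  \<open>e b \<le> q\<close> because that \<open>b\<close> lies in an earlier fibre.\<close>

lemma ultrafilter_near_coherence:
  fixes H K :: "nat filter"
  assumes NCF and H: "H \<noteq> bot" "H \<le> at_top"
    and ultra: "\<And>S. eventually (\<lambda>n. n \<in> S) H \<or> eventually (\<lambda>n. n \<notin> S) H"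
    and K: "K \<noteq> bot" "K \<le> at_top"
  shows "\<exists>e :: nat \<Rightarrow> nat. \<forall>A. eventually (\<lambda>n. n \<in> A) K \<longrightarrow>
    eventually (\<lambda>q. \<forall>b. e b \<le> q \<longrightarrow> (\<exists>m\<in>A. b \<le> m \<and> m \<le> e q)) H"
proof -
  obtain \<phi> :: "nat \<Rightarrow> nat" where \<phi>: "mono \<phi>" "surj \<phi>"
    and coh: "\<And>U V. eventually (\<lambda>n. n \<in> U) K \<Longrightarrow> eventually (\<lambda>n. n \<in> V) H \<Longrightarrow>
      \<exists>u\<in>U. \<exists>v\<in>V. \<phi> u = \<phi> v"
    by (rule NCF_nearly_coherent[OF \<open>NCF\<close> K H]) (rule that)
  obtain e where e: "\<And>n. \<phi> (e n) = Suc (\<phi> n)" "\<And>m n. \<phi> m = \<phi> n \<Longrightarrow> m < e n"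
    by (rule exists_next_fibre[OF \<phi>]) (rule that)
  have "eventually (\<lambda>q. \<forall>b. e b \<le> q \<longrightarrow> (\<exists>m\<in>A. b \<le> m \<and> m \<le> e q)) H"
    if A: "eventually (\<lambda>n. n \<in> A) K" for A
  proof -
    have "\<not> eventually (\<lambda>q. q \<notin> \<phi> -` \<phi> ` A) H"
    proof
      assume "eventually (\<lambda>q. q \<notin> \<phi> -` \<phi> ` A) H"
      then have "eventually (\<lambda>q. q \<in> {q. q \<notin> \<phi> -` \<phi> ` A}) H" by simp
      from coh[OF A this] obtain u v where "u \<in> A" "\<phi> v \<notin> \<phi> ` A" "\<phi> u = \<phi> v" by auto
      then show False by (metis imageI)
    qed
    then have "eventually (\<lambda>q. q \<in> \<phi> -` \<phi> ` A) H"
      using ultra[of "\<phi> -` \<phi> ` A"] by blast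
    then show ?thesis
    proof (rule eventually_mono, intro allI impI)
      fix q b assume "q \<in> \<phi> -` \<phi> ` A" and b: "e b \<le> q"
      then have "\<phi> q \<in> \<phi> ` A" by simp
      then obtain m where m: "m \<in> A" "\<phi> m = \<phi> q" by (metis imageE)
      have "\<phi> b < \<phi> m"
        using monoD[OF \<phi>(1) b] e(1)[of b] m(2) by simp
      then have "b \<le> m"
        using monoD[OF \<phi>(1), of m b] by (cases "b \<le> m") auto
      moreover have "m \<le> e q" using e(2)[OF m(2)] by simp
      ultimately show "\<exists>m\<in>A. b \<le> m \<and> m \<le> e q" using m(1) by blast
    qed
  qed
  then show ?thesis by blast
qed

section \<open>Selections from dense sets\<close>

lemma dense_subset_iff:
  "dense_subset X D \<longleftrightarrow>
    D \<subseteq> topspace X \<and> (\<forall>U. openin X U \<and> U \<noteq> {} \<longrightarrow> D \<inter> U \<noteq> {})"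
  unfolding dense_subset_def by (simp only: dense_intersects_open)

lemma mS_separable_imp_M_separable:
  assumes "mS_separable X" shows "M_separable X"
  unfolding M_separable_def
proof (intro allI impI)
  fix D :: "nat \<Rightarrow> 'a set" assume D: "\<forall>n. dense_subset X (D n)"
  define E where "E n = (\<Union>m\<in>{n..}. D m)" for n
  have "dense_subset X (E n)" for n
  proof -
    have "D n \<subseteq> E n" "E n \<subseteq> topspace X"
      using D unfolding E_def dense_subset_iff by auto
    then show ?thesis using D[THEN spec, of n] unfolding dense_subset_iff by blast
  qed
  moreover have "E (Suc n) \<subseteq> E n" for n
    unfolding E_def by force
  ultimately obtain F where F: "S_selects X E F"
    using assms unfolding mS_separable_def by blast
  \<comment> \<open>Only the sets \<open>F n\<close> with \<open>n \<le> m\<close> contribute, so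
    \<open>G m\<close> is finite. No point is lost, since a point of \<open>F n\<close> lies in some
    \<open>D m\<close> with \<open>m \<ge> n\<close>.\<close>
  define G where "G m = D m \<inter> (\<Union>n\<in>{..m}. F n)" for m
  have UN: "F n \<subseteq> (\<Union>m. G m)" for n
  proof
    fix y assume y: "y \<in> F n"
    then have "y \<in> E n" using F unfolding S_selects_def by blast
    then obtain m where "n \<le> m" "y \<in> D m" unfolding E_def by auto
    with y show "y \<in> (\<Union>m. G m)" unfolding G_def by auto
  qed
  have "finite (G m) \<and> G m \<subseteq> D m" for m
    using F unfolding G_def S_selects_def by auto
  moreover have "dense_subset X (\<Union>m. G m)"
    unfolding dense_subset_iff
  proof (intro conjI allI impI)
    show "(\<Union>m. G m) \<subseteq> topspace X"
      using D unfolding G_def dense_subset_iff by blast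
    fix U assume "openin X U \<and> U \<noteq> {}"
    then have "\<exists>n. \<forall>i<Suc 0. U \<inter> F n \<noteq> {}"
      using F unfolding S_selects_def by (elim conjE allE[of _ "Suc 0"] allE[of _ "\<lambda>_. U"]) simp
    then obtain n y where "y \<in> U" "y \<in> F n" by auto
    with UN[of n] have "y \<in> (\<Union>m. G m) \<inter> U" by (intro IntI subsetD[OF UN])
    then show "(\<Union>m. G m) \<inter> U \<noteq> {}" by (metis empty_iff)
  qed
  ultimately show "\<exists>F. (\<forall>n. finite (F n) \<and> F n \<subseteq> D n) \<and> dense_subset X (\<Union>n. F n)"
    by blast
qed

text \<open>M-separability is applied once for every \<open>p\<close>, to dense sets with indices in
  \<open>B\<close> beyond \<open>p\<close>. A single application would give one hit for each open
  set; all of them together give hits at arbitrarily large indices.\<close>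

lemma M_separable_along:
  fixes x :: "nat \<Rightarrow> 'a" and B :: "nat set"
  assumes M: "M_separable X" and D: "\<And>n. dense_subset X (D n)"
    and x: "topspace X = range x" and B: "infinite B"
  shows "\<exists>g. mono g \<and> (\<forall>U. openin X U \<and> U \<noteq> {} \<longrightarrow>
    (\<exists>\<^sub>F n in at_top. n \<in> {n\<in>B. U \<inter> D n \<inter> x ` {..g n} \<noteq> {}}))"
proof -
  have "\<forall>p. \<exists>n. n \<in> B \<and> p \<le> n"
    using B unfolding infinite_nat_iff_unbounded_le by blast
  from choice[OF this] obtain nx where nx: "\<And>p. nx p \<in> B" "\<And>p. p \<le> nx p" by blast
  have "\<forall>p. \<exists>F. (\<forall>i. finite (F i) \<and> F i \<subseteq> D (nx (i + p))) \<and> dense_subset X (\<Union>i. F i)"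
    using M[unfolded M_separable_def, rule_format] D by simp
  from choice[OF this] obtain F where F: "\<And>p i. finite (F p i)" "\<And>p i. F p i \<subseteq> D (nx (i + p))"
    "\<And>p. dense_subset X (\<Union>i. F p i)" by blast
  have "\<forall>z. \<exists>N. F (fst z) (snd z) \<subseteq> x ` {..N}"
  proof
    fix z
    have "F (fst z) (snd z) \<subseteq> range x"
      using F(2) D x unfolding dense_subset_iff by blast
    from finite_subset_image[OF F(1) this]
    obtain C where C: "finite C" "F (fst z) (snd z) = x ` C" by auto
    obtain k where "\<forall>n\<in>C. n \<le> k"
      using C(1) unfolding finite_nat_set_iff_bounded_le by blast
    then have "C \<subseteq> {..k}" by auto
    with C(2) have "F (fst z) (snd z) \<subseteq> x ` {..k}" by (simp add: image_mono)
    then show "\<exists>N. F (fst z) (snd z) \<subseteq> x ` {..N}" ..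
  qed
  from choice[OF this] obtain N where N: "\<And>z. F (fst z) (snd z) \<subseteq> x ` {..N z}" by blast
  \<comment> \<open>The set \<open>F p i\<close> is selected from \<open>D\<close> at index
    \<open>nx (i + p)\<close>, which is at least \<open>p\<close> and \<open>i\<close>, so its bound
    is among the summands there.\<close>
  define g where "g n = (\<Sum>z\<in>{..n} \<times> {..n}. N z)" for n
  have "mono g"
    unfolding g_def by (intro monoI sum_mono2) auto
  moreover have "\<exists>\<^sub>F n in at_top. n \<in> {n\<in>B. U \<inter> D n \<inter> x ` {..g n} \<noteq> {}}"
    if U: "openin X U \<and> U \<noteq> {}" for U
    unfolding frequently_sequentially
  proof
    fix p
    obtain i y where y: "y \<in> F p i" "y \<in> U"
      using F(3)[of p] U unfolding dense_subset_iff by blast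
    let ?n = "nx (i + p)"
    have n: "p \<le> ?n" "i \<le> ?n" using nx(2)[of "i + p"] by simp_all
    then have "N (p, i) \<le> g ?n"
      unfolding g_def by (intro member_le_sum) auto
    then have "x ` {..N (p, i)} \<subseteq> x ` {..g ?n}" by auto
    then have "y \<in> U \<inter> D ?n \<inter> x ` {..g ?n}"
      using y F(2)[of p i] N[of "(p, i)"] by auto
    with n(1) nx(1) show "\<exists>n\<ge>p. n \<in> {n\<in>B. U \<inter> D n \<inter> x ` {..g n} \<noteq> {}}" by blast
  qed
  ultimately show ?thesis by blast
qed

text \<open>Finitely many neighbourhoods of \<open>y\<close> have a common neighbourhood
  \<open>V\<close>, and by monotonicity \<open>A V\<close> lies inside all the corresponding
  generators.\<close>

lemma nbhd_filter_not_bot: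
  assumes y: "y \<in> topspace X"
    and freq: "\<And>U. openin X U \<and> y \<in> U \<Longrightarrow> \<exists>\<^sub>F n in F. n \<in> A U"
    and A: "\<And>U V. U \<subseteq> V \<Longrightarrow> A U \<subseteq> A V"
  shows "inf F (INF U\<in>{U. openin X U \<and> y \<in> U}. principal (A U)) \<noteq> bot"
proof
  let ?\<U> = "{U. openin X U \<and> y \<in> U}"
  assume "inf F (INF U\<in>?\<U>. principal (A U)) = bot"
  then obtain P Q where P: "eventually P F" and Q: "eventually Q (INF U\<in>?\<U>. principal (A U))"
    and PQ: "\<And>x. P x \<Longrightarrow> Q x \<Longrightarrow> False"
    unfolding trivial_limit_def eventually_inf by blast
  obtain \<X> where X: "\<X> \<subseteq> ?\<U>" "finite \<X>" and QX: "eventually Q (INF U\<in>\<X>. principal (A U))"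
    using eventually_INF[THEN iffD1, OF Q] by blast
  \<comment> \<open>Inserting the whole space covers the case of an empty family.\<close>
  define V where "V = \<Inter>(insert (topspace X) \<X>)"
  have V: "openin X V \<and> y \<in> V"
    unfolding V_def using X y by (intro conjI openin_Inter) auto
  have "A V \<subseteq> (\<Inter>U\<in>\<X>. A U)"
    by (intro INT_greatest A) (auto simp: V_def)
  moreover have "\<forall>n\<in>(\<Inter>U\<in>\<X>. A U). Q n"
    using QX X(2) by (simp only: INF_principal_finite eventually_principal)
  ultimately have "Q n" if "n \<in> A V" for n
    using that by blast
  with P PQ have "eventually (\<lambda>n. n \<notin> A V) F"
    by (blast intro: eventually_mono)
  with freq[OF V] show False by (simp add: frequently_def)
qed

lemma M_separable_imp_S_separable:
  assumes NCF and count: "countable (topspace X)" and M: "M_separable X"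
  shows "S_separable X"
  unfolding S_separable_def
proof (intro allI impI)
  fix D :: "nat \<Rightarrow> 'a set" assume dense: "\<forall>n. dense_subset X (D n)"
  show "\<exists>F. S_selects X D F"
  proof (cases "topspace X = {}")
    case True
    then have "openin X U \<Longrightarrow> U = {}" for U using openin_subset by blast
    then have "S_selects X D (\<lambda>_. {})" unfolding S_selects_def by auto
    then show ?thesis by blast
  next
    case False
    define x where "x = from_nat_into (topspace X)"
    have x: "topspace X = range x"
      unfolding x_def using range_from_nat_into[OF False count] by simp
    define hits where "hits g U = {n. U \<inter> D n \<inter> x ` {..g n} \<noteq> {}}" for g :: "nat \<Rightarrow> nat" and U
    obtain H :: "nat filter" where H: "small_filter H" "H \<noteq> bot" "H \<le> at_top"
      and ultra: "\<And>S. eventually (\<lambda>n. n \<in> S) H \<or> eventually (\<lambda>n. n \<notin> S) H"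
      by (rule NCF_small_ultrafilter[OF \<open>NCF\<close>]) (rule that)
    obtain \<B> where "small_base H \<B>" using H(1) unfolding small_filter_def by blast
    then have \<B>: "small \<B>" "\<And>P. eventually P H \<longleftrightarrow> (\<exists>B\<in>\<B>. \<forall>n\<in>B. P n)"
      unfolding small_base_def by blast+
    have inf: "infinite B" if "B \<in> \<B>" for B
    proof
      assume "finite B"
      then obtain k where k: "\<forall>n\<in>B. n < k" unfolding finite_nat_set_iff_bounded by blast
      have "eventually (\<lambda>n. n \<in> B) H" using \<B>(2) that by blast
      moreover have "eventually (\<lambda>n. k \<le> n) H" using H(3) eventually_ge_at_top by (rule filter_leD)
      ultimately have "eventually (\<lambda>_. False) H"
        by eventually_elim (use k in auto)
      with H(2) show False by (simp add: trivial_limit_def)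
    qed
    have "\<forall>B\<in>\<B>. \<exists>g. mono g \<and> (\<forall>U. openin X U \<and> U \<noteq> {} \<longrightarrow> (\<exists>\<^sub>F n in at_top. n \<in> B \<inter> hits g U))"
    proof
      fix B assume "B \<in> \<B>"
      from M_separable_along[OF M _ x inf[OF this], of D] dense
      show "\<exists>g. mono g \<and> (\<forall>U. openin X U \<and> U \<noteq> {} \<longrightarrow> (\<exists>\<^sub>F n in at_top. n \<in> B \<inter> hits g U))"
        unfolding hits_def Int_Collect by simp
    qed
    from bchoice[OF this] obtain G where G: "\<And>B. B \<in> \<B> \<Longrightarrow> mono (G B)"
      "\<And>B U. B \<in> \<B> \<Longrightarrow> openin X U \<and> U \<noteq> {} \<Longrightarrow> \<exists>\<^sub>F n in at_top. n \<in> B \<inter> hits (G B) U"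
      by blast
    \<comment> \<open>Here \<open>z\<close> is a pair of a base set and a point \<open>y\<close>.
      All neighbourhoods of \<open>y\<close> share one filter and hence one \<open>e\<close>;
      indexing by the countably many points instead of the open sets keeps the family of functions
      small.\<close>
    have "\<forall>z\<in>\<B> \<times> topspace X. \<exists>e :: nat \<Rightarrow> nat. \<forall>U. openin X U \<and> snd z \<in> U \<longrightarrow>
      (\<exists>Q\<in>\<B>. \<forall>q\<in>Q. \<forall>b. e b \<le> q \<longrightarrow> (\<exists>m\<in>fst z \<inter> hits (G (fst z)) U. b \<le> m \<and> m \<le> e q))"
    proof
      fix z assume z: "z \<in> \<B> \<times> topspace X"
      define A where "A U = fst z \<inter> hits (G (fst z)) U" for U
      define \<U> where "\<U> = {U. openin X U \<and> snd z \<in> U}"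
      let ?K = "inf at_top (INF U\<in>\<U>. principal (A U))"
      have "?K \<noteq> bot"
        unfolding \<U>_def
      proof (rule nbhd_filter_not_bot)
        show "snd z \<in> topspace X" using z by auto
        show "\<exists>\<^sub>F n in at_top. n \<in> A U" if "openin X U \<and> snd z \<in> U" for U
          unfolding A_def using z that by (intro G(2)) auto
        show "A U \<subseteq> A V" if "U \<subseteq> V" for U V
          unfolding A_def hits_def using that by blast
      qed
      moreover have "?K \<le> at_top" by simp
      ultimately obtain e where e: "\<forall>A. eventually (\<lambda>n. n \<in> A) ?K \<longrightarrow>
          eventually (\<lambda>q. \<forall>b. e b \<le> q \<longrightarrow> (\<exists>m\<in>A. b \<le> m \<and> m \<le> e q)) H"
        using ultrafilter_near_coherence[OF \<open>NCF\<close> H(2,3) ultra] by blast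
      have "eventually (\<lambda>n. n \<in> A U) ?K" if "U \<in> \<U>" for U
      proof -
        have "?K \<le> principal (A U)" using that by (intro le_infI2 INF_lower)
        then show ?thesis by (rule filter_leD) (simp add: eventually_principal)
      qed
      with e have "\<exists>Q\<in>\<B>. \<forall>q\<in>Q. \<forall>b. e b \<le> q \<longrightarrow> (\<exists>m\<in>A U. b \<le> m \<and> m \<le> e q)"
        if "U \<in> \<U>" for U
        using that unfolding \<B>(2) by simp
      then show "\<exists>e. \<forall>U. openin X U \<and> snd z \<in> U \<longrightarrow>
          (\<exists>Q\<in>\<B>. \<forall>q\<in>Q. \<forall>b. e b \<le> q \<longrightarrow> (\<exists>m\<in>fst z \<inter> hits (G (fst z)) U. b \<le> m \<and> m \<le> e q))"
        unfolding A_def \<U>_def by (intro exI[of _ e]) simp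
    qed
    from bchoice[OF this] obtain E :: "nat set \<times> 'a \<Rightarrow> nat \<Rightarrow> nat" where
      "\<forall>z\<in>\<B> \<times> topspace X. \<forall>U. openin X U \<and> snd z \<in> U \<longrightarrow>
        (\<exists>Q\<in>\<B>. \<forall>q\<in>Q. \<forall>b. E z b \<le> q \<longrightarrow>
          (\<exists>m\<in>fst z \<inter> hits (G (fst z)) U. b \<le> m \<and> m \<le> E z q))"
      by blast
    then have E: "\<exists>Q\<in>\<B>. \<forall>q\<in>Q. \<forall>b. E (B, y) b \<le> q \<longrightarrow>
        (\<exists>m\<in>B \<inter> hits (G B) U. b \<le> m \<and> m \<le> E (B, y) q)"
      if "B \<in> \<B>" "openin X U" "y \<in> U" for B U y
      using that openin_subset[OF that(2)] by (auto dest!: bspec[of _ _ "(B, y)"] spec[of _ U])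
    define next_in where "next_in Q k = (LEAST q. q \<in> Q \<and> k \<le> q)" for Q and k :: nat
    have next_in: "next_in Q k \<in> Q \<and> k \<le> next_in Q k" if "Q \<in> \<B>" for Q k
    proof -
      have "\<exists>q. q \<in> Q \<and> k \<le> q" using inf[OF that] unfolding infinite_nat_iff_unbounded_le by blast
      then show ?thesis unfolding next_in_def by (rule LeastI_ex)
    qed
    \<comment> \<open>If \<open>h ((B, y), Q) b < g b\<close> and \<open>q\<close> is the first element of \<open>Q\<close> beyond \<open>E (B, y) b\<close>, then the index \<open>m\<close>
      matched with \<open>q\<close> satisfies \<open>G B m \<le> h ((B, y), Q) b < g b \<le> g m\<close>.\<close>
    define h where "h = (\<lambda>(z, Q) b. G (fst z) (E z (next_in Q (E z b))))"
    \<comment> \<open>Besides the pair, the index records the base set \<open>Q\<close> on which the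
      bound of \<open>E\<close> holds, since \<open>Q\<close> depends on the open set.\<close>
    have "small ((\<B> \<times> topspace X) \<times> \<B>)"
      by (intro small_Times \<B>(1) small_countable count)
    then obtain g where "mono g" and g: "\<forall>i\<in>(\<B> \<times> topspace X) \<times> \<B>. \<exists>\<^sub>F n in at_top. h i n < g n"
      using small_nondominating_mono[where h = h] by blast
    \<comment> \<open>Otherwise some base set \<open>B\<close> misses \<open>hits g U\<close>. The
      contradiction is an index \<open>m\<close> in \<open>B\<close> at which \<open>g\<close> is at
      least \<open>G B\<close>, so that the hit for \<open>G B\<close> is also one for
      \<open>g\<close>.\<close>
    have hits: "eventually (\<lambda>n. n \<in> hits g U) H" if U: "openin X U" "U \<noteq> {}" for U
    proof (rule ccontr)
      assume "\<not> eventually (\<lambda>n. n \<in> hits g U) H"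
      then have "eventually (\<lambda>n. n \<notin> hits g U) H" using ultra by blast
      then obtain B where B: "B \<in> \<B>" "\<forall>n\<in>B. n \<notin> hits g U" unfolding \<B>(2) by blast
      obtain y where y: "y \<in> U" using U(2) by blast
      then have yX: "y \<in> topspace X" using openin_subset[OF U(1)] by blast
      obtain Q where Q: "Q \<in> \<B>" and EQ: "\<forall>q\<in>Q. \<forall>b. E (B, y) b \<le> q \<longrightarrow>
          (\<exists>m\<in>B \<inter> hits (G B) U. b \<le> m \<and> m \<le> E (B, y) q)"
        using E[OF B(1) U(1) y] by blast
      have "((B, y), Q) \<in> (\<B> \<times> topspace X) \<times> \<B>" using B(1) yX Q by simp
      from bspec[OF g this] obtain b where b: "h ((B, y), Q) b < g b"
        by (auto dest: frequently_ex)
      define q where "q = next_in Q (E (B, y) b)"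
      have "q \<in> Q" "E (B, y) b \<le> q" using next_in[OF Q] unfolding q_def by blast+
      then obtain m where m: "m \<in> B" "m \<in> hits (G B) U" "b \<le> m" "m \<le> E (B, y) q"
        using EQ by blast
      have "G B m \<le> G B (E (B, y) q)" using G(1)[OF B(1)] m(4) by (rule monoD)
      also have "\<dots> < g b" using b unfolding h_def q_def by simp
      also have "\<dots> \<le> g m" using \<open>mono g\<close> m(3) by (rule monoD)
      finally have "x ` {..G B m} \<subseteq> x ` {..g m}" by auto
      then have "m \<in> hits g U" using m(2) unfolding hits_def by blast
      with B(2) m(1) show False by blast
    qed
    define F where "F n = D n \<inter> x ` {..g n}" for n
    have "S_selects X D F"
      unfolding S_selects_def
    proof (intro conjI allI impI)
      fix k :: nat and U assume U: "\<forall>i<k. openin X (U i) \<and> U i \<noteq> {}"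
      \<comment> \<open>The finitely many index sets all belong to the proper filter
        \<open>H\<close>, so a single \<open>n\<close> serves every \<open>U i\<close>.\<close>
      have "eventually (\<lambda>n. \<forall>i\<in>{..<k}. n \<in> hits g (U i)) H"
        by (rule eventually_ball_finite) (use U hits in auto)
      from eventually_happens'[OF H(2) this] show "\<exists>n. \<forall>i<k. U i \<inter> F n \<noteq> {}"
        unfolding hits_def F_def by (auto simp: Int_assoc)
    qed (auto simp: F_def)
    then show ?thesis by blast
  qed
qed

theorem theorem1p1:
  fixes X :: "'a topology"
  assumes "NCF"
    and "countable (topspace X)"
  shows "(S_separable X \<longleftrightarrow> mS_separable X) \<and> (mS_separable X \<longleftrightarrow> M_separable X)"
proof -
  have "S_separable X \<Longrightarrow> mS_separable X"
    unfolding S_separable_def mS_separable_def by blast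
  then show ?thesis
    using mS_separable_imp_M_separable M_separable_imp_S_separable[OF assms] by blast
qed

end
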